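(* For an arbitrary subset $A\subset\mathbb{R}$, the following statements are equivalent: (1) $(\mathbb{R},\tau_A)$ is locally compact; (2) $(\mathbb{R},\tau_A)$ is a $k_\omega$-space; (3) $\mathbb{R}\setminus A$ is discrete (as a subspace) and closed in $(\mathbb{R},\tau_A)$.
   Context: For $A\subset\mathbb{R}$, $\tau_A$ is the topology on $\mathbb{R}$ in which each $x\in A$ has neighborhood base $\{(x-\varepsilon,x+\varepsilon):\varepsilon>0\}$ and each $x\in\mathbb{R}\setminus A$ has neighborhood base $\{[x,x+\varepsilon):\varepsilon>0\}$. A space $X$ is locally compact if every $x\in X$ has an open set $U$ and a compact set $K$ with $x\in U\subseteq K$. A space $X$ is a $k_\omega$-space if there is a countable family $\{K_n:n\in\mathbb{N}\}$ of compact subsets of $X$ such that each subset $F$ of $X$ is closed in $X$ provided that $F\cap K_n$ is closed in $K_n$ for each $n\in\mathbb{N}$. *)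

theory Defs
  imports "HOL-Analysis.Analysis"
begin

definition tau_nbhd :: "real set \<Rightarrow> real \<Rightarrow> real \<Rightarrow> real set" where
  "tau_nbhd A x e = (if x \<in> A then {x - e<..<x + e} else {x..<x + e})"

definition tau :: "real set \<Rightarrow> real topology" where
  "tau A = topology (\<lambda>U. \<forall>x\<in>U. \<exists>e>0. tau_nbhd A x e \<subseteq> U)"

lemma tau_nbhd_mono: "d \<le> e \<Longrightarrow> tau_nbhd A x d \<subseteq> tau_nbhd A x e"
  by (auto simp: tau_nbhd_def)

lemma istopology_tau: "istopology (\<lambda>U. \<forall>x\<in>U. \<exists>e>0. tau_nbhd A x e \<subseteq> U)"
  unfolding istopology_def
proof (intro conjI allI impI ballI)
  fix S T x
  assume S: "\<forall>x\<in>S. \<exists>e>0. tau_nbhd A x e \<subseteq> S"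
    and T: "\<forall>x\<in>T. \<exists>e>0. tau_nbhd A x e \<subseteq> T" and x: "x \<in> S \<inter> T"
  obtain d where d: "d > 0" "tau_nbhd A x d \<subseteq> S" using S x by blast
  obtain e where e: "e > 0" "tau_nbhd A x e \<subseteq> T" using T x by blast
  have "tau_nbhd A x (min d e) \<subseteq> S \<inter> T"
    using d(2) e(2) tau_nbhd_mono[of "min d e" d A x] tau_nbhd_mono[of "min d e" e A x] by auto
  then show "\<exists>e>0. tau_nbhd A x e \<subseteq> S \<inter> T"
    using d(1) e(1) by (intro exI[of _ "min d e"]) auto
next
  fix \<K> x
  assume "\<forall>K\<in>\<K>. \<forall>x\<in>K. \<exists>e>0. tau_nbhd A x e \<subseteq> K" "x \<in> \<Union>\<K>"
  then show "\<exists>e>0. tau_nbhd A x e \<subseteq> \<Union>\<K>"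
    by (meson Union_iff Union_upper order_trans)
qed

lemma openin_tau: "openin (tau A) U \<longleftrightarrow> (\<forall>x\<in>U. \<exists>e>0. tau_nbhd A x e \<subseteq> U)"
  by (simp add: tau_def istopology_tau)

lemma topspace_tau [simp]: "topspace (tau A) = UNIV"
proof -
  have "openin (tau A) UNIV" by (auto simp: openin_tau intro: exI[of _ 1])
  then show ?thesis using openin_subset by blast
qed

lemma openin_tau_nbhd: "openin (tau A) (tau_nbhd A x e)"
  unfolding openin_tau
proof
  fix y assume y: "y \<in> tau_nbhd A x e"
  let ?d = "if y = x then e else min \<bar>y - x\<bar> (e - \<bar>y - x\<bar>)"
  have "?d > 0" "tau_nbhd A y ?d \<subseteq> tau_nbhd A x e"
    using y by (auto simp: tau_nbhd_def split: if_splits)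
  then show "\<exists>d>0. tau_nbhd A y d \<subseteq> tau_nbhd A x e" by blast
qed

text \<open>The sets \<open>tau_nbhd A x e\<close> with \<open>e > 0\<close> form a neighbourhood base at \<open>x\<close>:\<close>

lemma tau_nbhd_base:
  "(\<exists>U. openin (tau A) U \<and> x \<in> U \<and> U \<subseteq> N) \<longleftrightarrow> (\<exists>e>0. tau_nbhd A x e \<subseteq> N)"
proof
  assume "\<exists>U. openin (tau A) U \<and> x \<in> U \<and> U \<subseteq> N"
  then show "\<exists>e>0. tau_nbhd A x e \<subseteq> N" by (meson openin_tau order_trans)
next
  assume "\<exists>e>0. tau_nbhd A x e \<subseteq> N"
  then obtain e where "e > 0" "tau_nbhd A x e \<subseteq> N" by blast
  moreover have "x \<in> tau_nbhd A x e" using \<open>e > 0\<close> by (simp add: tau_nbhd_def)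
  ultimately show "\<exists>U. openin (tau A) U \<and> x \<in> U \<and> U \<subseteq> N"
    using openin_tau_nbhd by blast
qed

definition k_omega_space :: "'a topology \<Rightarrow> bool" where
  "k_omega_space X \<longleftrightarrow>
     (\<exists>K :: nat \<Rightarrow> 'a set. (\<forall>n. compactin X (K n)) \<and>
        (\<forall>F. F \<subseteq> topspace X \<and> (\<forall>n. closedin (subtopology X (K n)) (F \<inter> K n)) \<longrightarrow> closedin X F))"

end

theory Submission
  imports Defs
begin

text \<open>
  The topology \<open>tau A\<close> is first countable, T1 and Lindelof: the Euclidean interiors of the members
  of a cover miss only a right-isolated, hence countable, set. In a first countable T1 space, a
  point none of whose basic neighbourhoods lies in one of the finite unions of the \<open>K\<^sub>n\<close> would be
  the limit of a sequence meeting each \<open>K\<^sub>n\<close> in a finite set, so its range would be closed; hence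
  such a space is locally compact if it is \<open>k\<^sub>\<omega>\<close>, and the Lindelof property gives the converse.
  A \<open>tau A\<close>-compact set is a Euclidean compact set that leaves a gap to the left of each point
  outside \<open>A\<close>, so a compact neighbourhood of \<open>x\<close> exists exactly when \<open>x\<close> is not an accumulation
  point of \<open>- A\<close>; and \<open>- A\<close> has no accumulation points iff it is closed and discrete.
\<close>

section \<open>Local compactness and the \<open>k_omega_space\<close> property in general
  spaces\<close>

lemma locally_compact_Lindelof_imp_k_omega_space:
  assumes lc: "locally_compact_space X" and L: "Lindelof_space X"
  shows "k_omega_space X"
proof -
  define \<U> where "\<U> = {U. openin X U \<and> (\<exists>K. compactin X K \<and> U \<subseteq> K)}"
  have "\<Union>\<U> = topspace X"
  proof
    show "\<Union>\<U> \<subseteq> topspace X"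
      using openin_subset by (fastforce simp: \<U>_def)
    show "topspace X \<subseteq> \<Union>\<U>"
      using lc unfolding locally_compact_space_def \<U>_def by blast
  qed
  moreover have "openin X U" if "U \<in> \<U>" for U
    using that by (simp add: \<U>_def)
  ultimately obtain \<V> where \<V>: "countable \<V>" "\<V> \<subseteq> \<U>" "\<Union>\<V> = topspace X"
    using Lindelof_spaceD[OF L] by metis
  \<comment> \<open>Adding \<open>{}\<close> keeps the family nonempty, so
    \<open>from_nat_into\<close> enumerates it even if \<open>\<V>\<close> is empty.\<close>
  define V where "V = from_nat_into (insert {} \<V>)"
  have ran: "range V = insert {} \<V>"
    unfolding V_def using \<V>(1) by (intro range_from_nat_into) auto
  have "{} \<in> \<U>"
    unfolding \<U>_def by (intro CollectI conjI exI[of _ "{}"]) simp_all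
  then have "range V \<subseteq> \<U>"
    using ran \<V>(2) by simp
  then have V: "V n \<in> \<U>" for n
    by blast
  then have "\<forall>n. \<exists>K. compactin X K \<and> V n \<subseteq> K"
    by (simp add: \<U>_def)
  then obtain K where K: "\<And>n. compactin X (K n)" "\<And>n. V n \<subseteq> K n"
    by metis
  have "closedin X F"
    if F: "F \<subseteq> topspace X" "\<And>n. closedin (subtopology X (K n)) (F \<inter> K n)" for F
    unfolding closedin_def
  proof (intro conjI F)
    show "openin X (topspace X - F)"
    proof (subst openin_subopen, intro ballI)
      fix y assume y: "y \<in> topspace X - F"
      then have "y \<in> \<Union> (range V)"
        using \<V>(3) ran by simp
      then obtain n where n: "y \<in> V n"
        by blast
      \<comment> \<open>Inside \<open>V n\<close>, a subset of \<open>K n\<close>, the set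
        \<open>F\<close> coincides with the closed set \<open>C\<close>, so \<open>V n - C\<close>
        is an open neighbourhood of \<open>y\<close> missing \<open>F\<close>.\<close>
      obtain C where C: "closedin X C" "F \<inter> K n = C \<inter> K n"
        using F(2)[of n] unfolding closedin_subtopology by blast
      have "openin X (V n)"
        using V by (auto simp: \<U>_def)
      then have "openin X (V n - C)"
        using C(1) openin_diff by blast
      moreover have "y \<in> V n - C" "V n - C \<subseteq> topspace X - F"
        using n y K(2)[of n] C(2) openin_subset[OF \<open>openin X (V n)\<close>] by blast+
      ultimately show "\<exists>T. openin X T \<and> y \<in> T \<and> T \<subseteq> topspace X - F"
        by blast
    qed
  qed
  then show ?thesis
    unfolding k_omega_space_def using K(1) by blast
qed

lemma k_omega_first_countable_imp_locally_compact_space: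
  assumes k: "k_omega_space X" and fc: "first_countable X" and t1: "t1_space X"
  shows "locally_compact_space X"
  unfolding locally_compact_space_def
proof
  fix x assume x: "x \<in> topspace X"
  obtain K :: "nat \<Rightarrow> 'a set" where K: "\<And>n. compactin X (K n)"
    and closed: "\<And>F. F \<subseteq> topspace X \<Longrightarrow> (\<And>n. closedin (subtopology X (K n)) (F \<inter> K n)) \<Longrightarrow> closedin X F"
    using k unfolding k_omega_space_def by blast
  obtain \<B> where \<B>: "countable \<B>" "\<And>V. V \<in> \<B> \<Longrightarrow> openin X V"
    "\<And>U. openin X U \<Longrightarrow> x \<in> U \<Longrightarrow> \<exists>V\<in>\<B>. x \<in> V \<and> V \<subseteq> U"
    using fc x unfolding first_countable_def by metis
  define \<C> where "\<C> = {V\<in>\<B>. x \<in> V}"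
  have ne: "\<C> \<noteq> {}"
    using \<B>(3)[of "topspace X"] x by (auto simp: \<C>_def)
  have ran: "range (from_nat_into \<C>) = \<C>"
    using \<B>(1) ne by (intro range_from_nat_into) (auto simp: \<C>_def)
  \<comment> \<open>Finite intersections turn the countable base at \<open>x\<close> into a
    decreasing one.\<close>
  define W where "W n = (\<Inter>i\<le>n. from_nat_into \<C> i)" for n
  have W: "openin X (W n)" "x \<in> W n" for n
  proof -
    have "from_nat_into \<C> i \<in> \<C>" for i
      using from_nat_into[OF ne] .
    then show "openin X (W n)" "x \<in> W n"
      using \<B>(2) by (auto simp: W_def \<C>_def intro!: openin_INT2)
  qed
  \<comment> \<open>Inserting \<open>x\<close> keeps \<open>L n\<close> compact and forces every
    point chosen outside \<open>L n\<close> to differ from \<open>x\<close>.\<close>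
  define L where "L n = insert x (\<Union>i\<le>n. K i)" for n
  have L: "compactin X (L n)" for n
  proof -
    have "compactin X ({x} \<union> \<Union> (K ` {..n}))"
      using K x by (intro compactin_Un compactin_Union) auto
    then show ?thesis
      by (simp add: L_def)
  qed
  have "\<exists>n. W n \<subseteq> L n"
  proof (rule ccontr)
    assume "\<nexists>n. W n \<subseteq> L n"
    then have "\<forall>n. \<exists>y. y \<in> W n \<and> y \<notin> L n"
      by blast
    then obtain y where y: "\<And>n. y n \<in> W n" "\<And>n. y n \<notin> L n"
      by metis
    have ytop: "range y \<subseteq> topspace X"
      using y(1) openin_subset[OF W(1)] by blast
    have "closedin X (range y)"
    proof (rule closed[OF ytop])
      fix n
      \<comment> \<open>For \<open>n \<le> m\<close> the set \<open>L m\<close> contains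
        \<open>K n\<close>, so \<open>y m\<close> avoids \<open>K n\<close>.\<close>
      have "range y \<inter> K n \<subseteq> y ` {..<n}"
      proof
        fix z assume z: "z \<in> range y \<inter> K n"
        then obtain m where m: "z = y m"
          by blast
        have "\<not> n \<le> m"
          using z m y(2)[of m] by (auto simp: L_def)
        then show "z \<in> y ` {..<n}"
          using m by auto
      qed
      then have "finite (range y \<inter> K n)"
        using finite_subset by blast
      then have "closedin X (range y \<inter> K n)"
        using t1 ytop unfolding t1_space_closedin_finite by blast
      then show "closedin (subtopology X (K n)) (range y \<inter> K n)"
        by (auto simp: closedin_subtopology)
    qed
    \<comment> \<open>This complement is a neighbourhood of \<open>x\<close>, so it contains some
      \<open>W n\<close> and with it \<open>y n\<close>, a contradiction.\<close>
    then have "openin X (topspace X - range y)"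
      by blast
    moreover have "x \<notin> range y"
      using y(2) by (auto simp: L_def)
    ultimately obtain V where V: "V \<in> \<C>" "V \<subseteq> topspace X - range y"
      using \<B>(3)[of "topspace X - range y"] x by (auto simp: \<C>_def)
    then obtain n where "V = from_nat_into \<C> n"
      using ran by blast
    then have "W n \<subseteq> V"
      by (auto simp: W_def)
    then show False
      using y(1)[of n] V(2) by blast
  qed
  then show "\<exists>U K. openin X U \<and> compactin X K \<and> x \<in> U \<and> U \<subseteq> K"
    using W L by blast
qed

text \<open>Discreteness says that the derived set is disjoint from \<open>S\<close>, closedness
  that it lies inside \<open>S\<close>; together they leave it empty.\<close>

lemma subtopology_discrete_and_closedin_iff_derived_set_of:
  "subtopology X S = discrete_topology S \<and> closedin X S \<longleftrightarrow>
    S \<subseteq> topspace X \<and> X derived_set_of S = {}"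
  unfolding subtopology_eq_discrete_topology_eq closedin_contains_derived_set by blast

text \<open>The gaps to the right of distinct points are disjoint, so choosing a rational in each
  gap is injective.\<close>

lemma countable_right_isolated:
  fixes S :: "real set"
  assumes "\<And>x. x \<in> S \<Longrightarrow> \<exists>e>0. {x<..<x + e} \<inter> S = {}"
  shows "countable S"
proof -
  obtain e where e: "\<And>x. x \<in> S \<Longrightarrow> e x > 0 \<and> {x<..<x + e x} \<inter> S = {}"
    using assms by metis
  have "\<exists>q\<in>\<rat>. x < q \<and> q < x + e x" if "x \<in> S" for x
    using e[OF that] by (intro Rats_dense_in_real) auto
  then obtain q where q: "\<And>x. x \<in> S \<Longrightarrow> q x \<in> \<rat> \<and> x < q x \<and> q x < x + e x"
    by metis
  \<comment> \<open>The point \<open>y\<close> lies beyond the gap of \<open>x\<close>, hence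
    \<open>q x < x + e x \<le> y < q y\<close>.\<close>
  have less: "q x < q y" if "x \<in> S" "y \<in> S" "x < y" for x y
  proof -
    have "\<not> y < x + e x"
      using e[OF that(1)] that by auto
    then show ?thesis
      using q[OF that(1)] q[OF that(2)] by linarith
  qed
  have "inj_on q S"
    by (rule linorder_inj_onI) (use less in force)+
  moreover have "q ` S \<subseteq> \<rat>"
    using q by blast
  ultimately show ?thesis
    using countable_rat countable_subset countable_image_inj_on by metis
qed

section \<open>Comparison of \<open>tau A\<close> with the Euclidean topology; separation and
  countability properties\<close>

lemma openin_tau_open:
  assumes "open U"
  shows "openin (tau A) U"
  unfolding openin_tau
proof
  fix x assume "x \<in> U"
  then obtain e where "e > 0" "ball x e \<subseteq> U"
    using assms open_contains_ball by blast
  moreover have "tau_nbhd A x e \<subseteq> ball x e"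
    by (auto simp: tau_nbhd_def dist_real_def)
  ultimately show "\<exists>e>0. tau_nbhd A x e \<subseteq> U"
    by blast
qed

lemma continuous_map_tau_euclidean: "continuous_map (tau A) euclidean id"
  by (simp add: continuous_map_def openin_tau_open)

lemma t1_space_tau: "t1_space (tau A)"
  unfolding t1_space_def
proof (intro ballI impI)
  fix x y :: real assume "x \<noteq> y"
  then show "\<exists>U. openin (tau A) U \<and> x \<in> U \<and> y \<notin> U"
    by (intro exI[of _ "- {y}"]) (auto intro: openin_tau_open)
qed

lemma first_countable_tau: "first_countable (tau A)"
  unfolding first_countable_def
proof
  fix x :: real
  define \<B> where "\<B> = range (\<lambda>n. tau_nbhd A x (1 / real (Suc n)))"
  have "\<exists>V\<in>\<B>. x \<in> V \<and> V \<subseteq> U" if "openin (tau A) U" "x \<in> U" for U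
  proof -
    obtain e where e: "e > 0" "tau_nbhd A x e \<subseteq> U"
      using \<open>openin (tau A) U\<close> \<open>x \<in> U\<close> unfolding openin_tau by blast
    obtain n where n: "1 / real (Suc n) < e"
      using e(1) nat_approx_posE by blast
    have "tau_nbhd A x (1 / real (Suc n)) \<subseteq> U"
      using tau_nbhd_mono[of "1 / real (Suc n)" e A x] n e(2) by auto
    moreover have "x \<in> tau_nbhd A x (1 / real (Suc n))"
      by (simp add: tau_nbhd_def)
    ultimately show ?thesis
      unfolding \<B>_def by blast
  qed
  moreover have "countable \<B>" "\<forall>V\<in>\<B>. openin (tau A) V"
    by (auto simp: \<B>_def openin_tau_nbhd)
  ultimately show "\<exists>\<B>. countable \<B> \<and> (\<forall>V\<in>\<B>. openin (tau A) V) \<and>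
      (\<forall>U. openin (tau A) U \<and> x \<in> U \<longrightarrow> (\<exists>V\<in>\<B>. x \<in> V \<and> V \<subseteq> U))"
    by blast
qed

lemma Lindelof_space_tau: "Lindelof_space (tau A)"
  unfolding Lindelof_space_def
proof (intro allI impI, elim conjE)
  fix \<U> assume opn: "\<forall>U\<in>\<U>. openin (tau A) U" and cover: "\<Union>\<U> = topspace (tau A)"
  \<comment> \<open>The Euclidean line is hereditarily Lindelof, so countably many interiors have
    the same union as all of them.\<close>
  obtain \<I> where \<I>: "\<I> \<subseteq> interior ` \<U>" "countable \<I>" "\<Union>\<I> = (\<Union>U\<in>\<U>. interior U)"
    using Lindelof[of "interior ` \<U>"] by auto
  obtain \<V> where \<V>: "\<V> \<subseteq> \<U>" "countable \<V>" "\<I> = interior ` \<V>"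
    using \<I>(1,2) countable_subset_image by metis
  define S where "S = - (\<Union>U\<in>\<U>. interior U)"
  have "countable S"
  proof (rule countable_right_isolated)
    fix x assume "x \<in> S"
    obtain U where U: "U \<in> \<U>" "x \<in> U"
      using cover by auto
    then obtain e where e: "e > 0" "tau_nbhd A x e \<subseteq> U"
      using opn by (meson openin_tau)
    \<comment> \<open>Both kinds of basic neighbourhood contain this open interval; it lies in the
      interior of \<open>U\<close> and therefore misses \<open>S\<close>.\<close>
    have "{x<..<x + e} \<subseteq> tau_nbhd A x e"
      by (auto simp: tau_nbhd_def)
    then have "{x<..<x + e} \<subseteq> interior U"
      using e(2) by (intro interior_maximal) auto
    then show "\<exists>e>0. {x<..<x + e} \<inter> S = {}"
      using e(1) U(1) by (auto simp: S_def)
  qed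
  have "\<forall>x. \<exists>U. U \<in> \<U> \<and> x \<in> U"
    using cover by auto
  then obtain u where u: "\<And>x. u x \<in> \<U> \<and> x \<in> u x"
    by metis
  have "x \<in> \<Union> (\<V> \<union> u ` S)" for x
  proof (cases "x \<in> S")
    case False
    then have "x \<in> (\<Union>V\<in>\<V>. interior V)"
      using \<I>(3) \<V>(3) by (simp add: S_def)
    then show ?thesis
      using interior_subset by blast
  next
    case True
    then have "u x \<in> u ` S"
      by blast
    then show ?thesis
      using u[of x] by blast
  qed
  then have "\<Union> (\<V> \<union> u ` S) = topspace (tau A)"
    by (auto simp del: Union_Un_distrib)
  then show "\<exists>\<V>. countable \<V> \<and> \<V> \<subseteq> \<U> \<and> \<Union>\<V> = topspace (tau A)"
    using \<V>(1,2) u \<open>countable S\<close> by (intro exI[of _ "\<V> \<union> u ` S"]) blast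
qed

section \<open>Compact subsets of \<open>tau A\<close>\<close>

lemma compactin_tau_left_gap:
  assumes K: "compactin (tau A) K" and x: "x \<notin> A"
  shows "\<exists>d>0. {x - d<..<x} \<inter> K = {}"
proof -
  \<comment> \<open>Since \<open>x \<notin> A\<close>, the part of \<open>K\<close> left of
    \<open>x\<close> is closed in \<open>K\<close>. It is thus compact in \<open>tau A\<close>,
    hence also in the coarser Euclidean topology, and so stays at a positive distance from
    \<open>x\<close>.\<close>
  have "openin (tau A) {x..}"
    unfolding openin_tau
  proof
    fix y assume "y \<in> {x..}"
    with x have "tau_nbhd A y (if y = x then 1 else y - x) \<subseteq> {x..}"
      by (auto simp: tau_nbhd_def split: if_splits)
    with \<open>y \<in> {x..}\<close> show "\<exists>e>0. tau_nbhd A y e \<subseteq> {x..}"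
      by (intro exI[of _ "if y = x then 1 else y - x"]) auto
  qed
  moreover have "- {..<x} = {x..}"
    by auto
  ultimately have "closedin (tau A) {..<x}"
    by (simp add: closedin_def Compl_eq_Diff_UNIV)
  then have "compactin (tau A) ({..<x} \<inter> K)"
    using K closed_Int_compactin by blast
  then have "compact ({..<x} \<inter> K)"
    using image_compactin[OF _ continuous_map_tau_euclidean] by fastforce
  then have "open (- ({..<x} \<inter> K))"
    using compact_imp_closed by blast
  then obtain d where "d > 0" "ball x d \<subseteq> - ({..<x} \<inter> K)"
    by (auto simp: open_contains_ball)
  moreover have "{x - d<..<x} \<subseteq> ball x d \<inter> {..<x}"
    by (auto simp: dist_real_def)
  ultimately show ?thesis
    by (intro exI[of _ d]) blast
qed

text \<open>With a left gap at \<open>x\<close>, the trace on \<open>K\<close> of a small Euclidean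
  ball is already one-sided. So the identity from the Euclidean \<open>K\<close> to
  \<open>tau A\<close> is continuous, and its image is compact.\<close>

lemma compact_left_gaps_imp_compactin_tau:
  assumes K: "compact K" and gap: "\<And>x. x \<in> K \<Longrightarrow> x \<notin> A \<Longrightarrow> \<exists>d>0. {x - d<..<x} \<inter> K = {}"
  shows "compactin (tau A) K"
proof -
  have "openin (top_of_set K) {x \<in> K. x \<in> U}" if U: "openin (tau A) U" for U
    unfolding openin_euclidean_subtopology_iff
  proof (intro conjI ballI)
    fix x assume "x \<in> {x \<in> K. x \<in> U}"
    then have x: "x \<in> K" "x \<in> U"
      by auto
    then obtain e where e: "e > 0" "tau_nbhd A x e \<subseteq> U"
      using U unfolding openin_tau by blast
    \<comment> \<open>The value 1 is a placeholder for \<open>x \<in> A\<close>, where basic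
      neighbourhoods are two-sided.\<close>
    have "\<exists>d>0. x \<notin> A \<longrightarrow> {x - d<..<x} \<inter> K = {}"
      using gap[OF x(1)] by (cases "x \<in> A") (auto intro: exI[of _ 1])
    then obtain d where d: "d > 0" "x \<notin> A \<Longrightarrow> {x - d<..<x} \<inter> K = {}"
      by blast
    have "y \<in> tau_nbhd A x e" if "y \<in> K" "dist y x < min d e" for y
    proof -
      have "y \<in> {x - d<..<x} \<inter> K" if "y < x"
        using that \<open>y \<in> K\<close> \<open>dist y x < min d e\<close> by (auto simp: dist_real_def)
      then have "x \<notin> A \<Longrightarrow> \<not> y < x"
        using d(2) by blast
      then show ?thesis
        using that by (auto simp: tau_nbhd_def dist_real_def)
    qed
    then show "\<exists>e>0. \<forall>y\<in>K. dist y x < e \<longrightarrow> y \<in> {x \<in> K. x \<in> U}"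
      using e d(1) by (intro exI[of _ "min d e"]) auto
  qed auto
  then have "continuous_map (top_of_set K) (tau A) id"
    by (simp add: continuous_map_def)
  moreover have "compactin (top_of_set K) K"
    using K by (simp add: compactin_subtopology)
  ultimately show ?thesis
    using image_compactin by fastforce
qed

section \<open>Accumulation points of \<open>- A\<close> and compact neighbourhoods\<close>

lemma derived_set_of_tau_eq_empty_iff:
  "tau A derived_set_of (- A) = {} \<longleftrightarrow> (\<forall>x. \<exists>e>0. tau_nbhd A x e \<subseteq> insert x A)"
proof -
  \<comment> \<open>A neighbourhood meeting \<open>- A\<close> at most in \<open>x\<close> is one
    contained in \<open>insert x A\<close>.\<close>
  have "x \<notin> tau A derived_set_of (- A) \<longleftrightarrow>
      (\<exists>U. openin (tau A) U \<and> x \<in> U \<and> U \<subseteq> insert x A)" for x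
    by (auto simp: derived_set_of_def)
  then show ?thesis
    unfolding tau_nbhd_base by blast
qed

lemma locally_compact_space_tau_iff:
  "locally_compact_space (tau A) \<longleftrightarrow> (\<forall>x. \<exists>e>0. tau_nbhd A x e \<subseteq> insert x A)"
proof (intro iffI allI)
  fix x assume "locally_compact_space (tau A)"
  then obtain U K where UK: "openin (tau A) U" "compactin (tau A) K" "x \<in> U" "U \<subseteq> K"
    unfolding locally_compact_space_def topspace_tau by blast
  then obtain e where e: "e > 0" "tau_nbhd A x e \<subseteq> K"
    unfolding openin_tau by (meson order_trans)
  have "y \<in> insert x A" if y: "y \<in> tau_nbhd A x e" for y
  proof (rule ccontr)
    assume "y \<notin> insert x A"
    then obtain d where d: "d > 0" "{y - d<..<y} \<inter> K = {}" and "y \<noteq> x"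
      using compactin_tau_left_gap[OF UK(2)] by blast
    \<comment> \<open>All points between \<open>l\<close> and \<open>y\<close> stay in
      \<open>tau_nbhd A x e\<close>, hence in \<open>K\<close>, and those close to \<open>y\<close>
      contradict the left gap. The case \<open>y < x\<close> arises only for
      \<open>x \<in> A\<close>.\<close>
    define l where "l = (if y < x then x - e else x)"
    have "l < y"
      using y \<open>y \<noteq> x\<close> by (auto simp: l_def tau_nbhd_def split: if_splits)
    then obtain z where z: "max l (y - d) < z" "z < y"
      using d(1) dense[of "max l (y - d)" y] by auto
    then have "z \<in> tau_nbhd A x e"
      using y \<open>y \<noteq> x\<close> by (auto simp: l_def tau_nbhd_def split: if_splits)
    then show False
      using z d(2) e(2) by auto
  qed
  then show "\<exists>e>0. tau_nbhd A x e \<subseteq> insert x A"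
    using e(1) by blast
next
  assume isolated: "\<forall>x. \<exists>e>0. tau_nbhd A x e \<subseteq> insert x A"
  show "locally_compact_space (tau A)"
    unfolding locally_compact_space_def
  proof
    fix x
    obtain e where e: "e > 0" "tau_nbhd A x e \<subseteq> insert x A"
      using isolated by blast
    \<comment> \<open>Halving the radius fits a closed interval into \<open>tau_nbhd A x e\<close>,
      so only \<open>x\<close> itself can be a point of \<open>K\<close> outside
      \<open>A\<close>.\<close>
    define K where "K = (if x \<in> A then {x - e/2..x + e/2} else {x..x + e/2})"
    have "compactin (tau A) K"
    proof (rule compact_left_gaps_imp_compactin_tau)
      show "compact K"
        by (simp add: K_def)
      fix y assume y: "y \<in> K" "y \<notin> A"
      have "K \<subseteq> tau_nbhd A x e"
        using e(1) by (auto simp: K_def tau_nbhd_def)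
      then have "y = x"
        using y e(2) by blast
      \<comment> \<open>Here \<open>x \<notin> A\<close>, so \<open>y\<close> is the left endpoint
        of \<open>K\<close> and any gap width serves.\<close>
      then show "\<exists>d>0. {y - d<..<y} \<inter> K = {}"
        using y by (intro exI[of _ 1]) (auto simp: K_def)
    qed
    moreover have "tau_nbhd A x (e/2) \<subseteq> K" "x \<in> tau_nbhd A x (e/2)"
      using e(1) by (auto simp: K_def tau_nbhd_def)
    ultimately show "\<exists>U K. openin (tau A) U \<and> compactin (tau A) K \<and> x \<in> U \<and> U \<subseteq> K"
      using openin_tau_nbhd by blast
  qed
qed

theorem theorem3p6:
  fixes A :: "real set"
  shows "(locally_compact_space (tau A) \<longleftrightarrow> k_omega_space (tau A)) \<and>
    (k_omega_space (tau A) \<longleftrightarrow>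
      subtopology (tau A) (- A) = discrete_topology (- A) \<and> closedin (tau A) (- A))"
proof -
  have "locally_compact_space (tau A) \<longleftrightarrow> k_omega_space (tau A)"
    using locally_compact_Lindelof_imp_k_omega_space Lindelof_space_tau
      k_omega_first_countable_imp_locally_compact_space first_countable_tau t1_space_tau
    by blast
  moreover have "locally_compact_space (tau A) \<longleftrightarrow>
      subtopology (tau A) (- A) = discrete_topology (- A) \<and> closedin (tau A) (- A)"
    unfolding subtopology_discrete_and_closedin_iff_derived_set_of
    by (simp add: locally_compact_space_tau_iff derived_set_of_tau_eq_empty_iff)
  ultimately show ?thesis
    by blast
qed

end
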